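(* Let $S$ be a $d$-variate spectral random vector and let $E$ be a unit exponential random variable independent of $S$. Then $$S+E\sim\operatorname{GP}(\mathbf 1,\mathbf 0,\pi,\ell),$$ where $\pi$ and $\ell$ are given by $$\pi_j=\mathbb E[e^{S_j}],\quad j=1,\dots,d,\qquad \ell(y)=\mathbb E\Bigl[\max_{j=1,\dots,d}\bigl(y_je^{S_j}/\pi_j\bigr)\Bigr],\quad y\in[0,\infty)^d.$$ The associated cdf is given by $$H(z)=1-\mathbb E\bigl[1\wedge e^{\max(S-z)}\bigr],\qquad z\in\mathbb R^d.$$
   Context: Conventions: operations and order relations between vectors are componentwise, scalars being added to every component; $a\wedge b=\min(a,b)$; $\max(x)=\max(x_1,\dots,x_d)$; $e^{-\infty}=0$; $\mathbf 1=(1,\dots,1)$, $\mathbf 0=(0,\dots,0)$. A random vector $S$ with values in $[-\infty,0]^d$ is called a spectral random vector if (S1) $\Pr[\max(S_1,\dots,S_d)=0]=1$ and (S2) $\Pr[S_j>-\infty]>0$ for all $j=1,\dots,d$. A function $\ell:[0,\infty)^d\to[0,\infty)$ is a stable tail dependence function (stdf) if there is a random vector $V$ with values in $[0,\infty)^d$ and $\mathbb E[V_j]=1$ for all $j$ such that $\ell(y)=\mathbb E[\max_{j}(y_jV_j)]$ for all $y\in[0,\infty)^d$. For $\pi\in(0,1]^d$ and a stdf $\ell$ with $\ell(\pi)=1$, $\operatorname{GP}(\mathbf 1,\mathbf 0,\pi,\ell)$ is the (standardized multivariate generalized Pareto) probability distribution concentrated on $[-\infty,\infty)^d\setminus[-\infty,0]^d$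 with cdf $H(z)=\ell(\pi e^{-(z\wedge 0)})-\ell(\pi e^{-z})$, $z\in\mathbb R^d$. (The assertion includes that $\pi\in(0,1]^d$, that $\ell$ is a stdf, and that $\ell(\pi)=1$.) *)

theory Defs
  imports "HOL-Probability.Probability"
begin

text \<open>
  Vectors of dimension $d$ are functions on a finite index type \<open>'d\<close> with $d$ elements; vectors with
  entries in $[-\infty,\infty]$ have type \<open>'d \<Rightarrow> ereal\<close>. The product sigma-algebra is
  the Borel sigma-algebra on these (finite-dimensional) spaces.
\<close>

abbreviation ereal_vectors :: "('d::finite \<Rightarrow> ereal) measure"
  where "ereal_vectors \<equiv> Pi\<^sub>M UNIV (\<lambda>_. borel)"

abbreviation real_vectors :: "('d::finite \<Rightarrow> real) measure"
  where "real_vectors \<equiv> Pi\<^sub>M UNIV (\<lambda>_. borel)"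

text \<open>
  $e^x$ with $e^{-\infty}=0$. The value at \<open>\<infinity>\<close> is a dummy: the function is only applied to
  arguments below \<open>\<infinity>\<close>.
\<close>

definition exp_ereal :: "ereal \<Rightarrow> real" where
  "exp_ereal x = (if \<bar>x\<bar> = \<infinity> then 0 else exp (real_of_ereal x))"

text \<open>
  The library constant \<open>indep_var\<close> requires both variables to have the same value type; the following
  is the same condition for two different value spaces.
\<close>

definition indep_rvs ::
  "'a measure \<Rightarrow> 'b measure \<Rightarrow> ('a \<Rightarrow> 'b) \<Rightarrow> 'c measure \<Rightarrow> ('a \<Rightarrow> 'c) \<Rightarrow> bool" where
  "indep_rvs M N X L Y \<longleftrightarrow>
     X \<in> M \<rightarrow>\<^sub>M N \<and> Y \<in> M \<rightarrow>\<^sub>M L \<and>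
     prob_space.indep_set M {X -` A \<inter> space M | A. A \<in> sets N} {Y -` B \<inter> space M | B. B \<in> sets L}"

definition spectral_random_vector :: "'a measure \<Rightarrow> ('a \<Rightarrow> 'd::finite \<Rightarrow> ereal) \<Rightarrow> bool" where
  "spectral_random_vector M S \<longleftrightarrow>
     S \<in> M \<rightarrow>\<^sub>M ereal_vectors \<and>
     (\<forall>\<omega>\<in>space M. \<forall>j. S \<omega> j \<le> 0) \<and>
     measure M {\<omega> \<in> space M. (MAX j. S \<omega> j) = 0} = 1 \<and>
     (\<forall>j. measure M {\<omega> \<in> space M. S \<omega> j > -\<infinity>} > 0)"

text \<open>
  The probability space of $V$ may be taken to live on the type \<open>'d \<Rightarrow> real\<close> without loss of
  generality, since the conditions depend only on the law of $V$. Only the values of \<open>l\<close> on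
  $[0,\infty)^d$ are constrained.
\<close>

definition is_stdf :: "(('d::finite \<Rightarrow> real) \<Rightarrow> real) \<Rightarrow> bool" where
  "is_stdf l \<longleftrightarrow>
     (\<exists>(N :: ('d \<Rightarrow> real) measure) (V :: ('d \<Rightarrow> real) \<Rightarrow> 'd \<Rightarrow> real).
        prob_space N \<and> V \<in> N \<rightarrow>\<^sub>M real_vectors \<and>
        (\<forall>\<omega>\<in>space N. \<forall>j. 0 \<le> V \<omega> j) \<and>
        (\<forall>j. has_bochner_integral N (\<lambda>\<omega>. V \<omega> j) 1) \<and>
        (\<forall>y. (\<forall>j. 0 \<le> y j) \<longrightarrow> l y = (\<integral>\<omega>. (MAX j. y j * V \<omega> j) \<partial>N)))"

definition vec_cdf :: "('d::finite \<Rightarrow> ereal) measure \<Rightarrow> ('d \<Rightarrow> real) \<Rightarrow> real" where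
  "vec_cdf \<mu> z = measure \<mu> {x \<in> space \<mu>. \<forall>j. x j \<le> ereal (z j)}"

text \<open>
  \<open>is_GP_std \<mu> p l\<close>: the law \<open>\<mu>\<close> is $\mathrm{GP}(\mathbf 1,\mathbf 0,p,l)$.
\<close>

definition is_GP_std ::
  "('d::finite \<Rightarrow> ereal) measure \<Rightarrow> ('d \<Rightarrow> real) \<Rightarrow> (('d \<Rightarrow> real) \<Rightarrow> real) \<Rightarrow> bool" where
  "is_GP_std \<mu> p l \<longleftrightarrow>
     (\<forall>j. 0 < p j \<and> p j \<le> 1) \<and> is_stdf l \<and> l p = 1 \<and>
     prob_space \<mu> \<and> sets \<mu> = sets ereal_vectors \<and>
     (AE x in \<mu>. (\<forall>j. x j < \<infinity>) \<and> \<not> (\<forall>j. x j \<le> 0)) \<and>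
     (\<forall>z. vec_cdf \<mu> z = l (\<lambda>j. p j * exp (- min (z j) 0)) - l (\<lambda>j. p j * exp (- z j)))"

end

theory Submission
  imports Defs
begin

text \<open>
  With $W_j = e^{S_j}$ and $a = \max_j e^{-z_j} W_j = e^{\max(S-z)}$, the event $S + E \le z$ is
  $a \le e^{-E}$, where $e^{-E}$ is uniform on $(0,1)$ and independent of $a$; conditioning on $S$
  gives $H(z) = E[1 - (1 \wedge a)]$. As $\max_j W_j = 1$ almost surely, one has
  $\max_j e^{-(z_j \wedge 0)} W_j = 1 \vee a$, and $(1 \vee a) - a = 1 - (1 \wedge a)$ identifies
  this expectation with the generalized Pareto cdf.
\<close>

section \<open>The exponential on extended reals\<close>

lemma exp_ereal_simps [simp]:
  "exp_ereal (ereal x) = exp x" "exp_ereal (-\<infinity>) = 0" "exp_ereal 0 = 1"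
  by (auto simp: exp_ereal_def zero_ereal_def)

lemma exp_ereal_nonneg [simp]: "0 \<le> exp_ereal x"
  by (simp add: exp_ereal_def)

text \<open>The dummy value 0 at \<infinity> would break monotonicity, so \<open>y\<close> must
  avoid it; \<open>x\<close> then avoids it as well.\<close>

lemma exp_ereal_mono: "x \<le> y \<Longrightarrow> y \<noteq> \<infinity> \<Longrightarrow> exp_ereal x \<le> exp_ereal y"
  by (cases x; cases y) auto

lemma exp_ereal_le_1: "x \<le> 0 \<Longrightarrow> exp_ereal x \<le> 1"
  using exp_ereal_mono[of x 0] by simp

lemma exp_ereal_pos_iff: "x \<noteq> \<infinity> \<Longrightarrow> 0 < exp_ereal x \<longleftrightarrow> -\<infinity> < x"
  by (cases x) auto

lemma exp_ereal_minus: "x \<noteq> \<infinity> \<Longrightarrow> exp_ereal (x - ereal z) = exp (- z) * exp_ereal x"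
  by (cases x) (auto simp: exp_diff exp_minus field_simps)

text \<open>Exponentiate \<open>x - z \<le> - e\<close>; at \<open>x = -\<infinity>\<close> both
  sides are true. This moves the cdf event from extended reals to reals.\<close>

lemma add_ereal_le_iff_exp_ereal:
  "x \<noteq> \<infinity> \<Longrightarrow> x + ereal e \<le> ereal z \<longleftrightarrow> exp (- z) * exp_ereal x \<le> exp (- e)"
  by (cases x) (auto simp flip: exp_add)

text \<open>A finite maximum is attained, which gives one inequality and also keeps the maximum away
  from \<infinity>; monotonicity then gives the other.\<close>

lemma exp_ereal_Max:
  fixes f :: "'d::finite \<Rightarrow> ereal"
  assumes "\<And>j. f j \<noteq> \<infinity>"
  shows "exp_ereal (MAX j. f j) = (MAX j. exp_ereal (f j))"
proof (rule antisym)
  have "(MAX j. f j) \<in> range f"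
    by (rule Max_in) auto
  then obtain i where i: "(MAX j. f j) = f i"
    by blast
  then show "exp_ereal (MAX j. f j) \<le> (MAX j. exp_ereal (f j))"
    by (simp only:) (simp add: Max_ge)
  have "(MAX j. f j) \<noteq> \<infinity>"
    using i assms by metis
  then show "(MAX j. exp_ereal (f j)) \<le> exp_ereal (MAX j. f j)"
    by (auto intro!: exp_ereal_mono)
qed

lemma measurable_exp_ereal [measurable]: "exp_ereal \<in> borel_measurable borel"
  unfolding exp_ereal_def by measurable

section \<open>Independence and the exponential distribution\<close>

text \<open>By independence both measures agree on measurable rectangles, which determine a product
  of sigma-finite measures. This opens the way to Fubini for the pair.\<close>

lemma (in prob_space) indep_rvs_distr_pair:
  assumes "indep_rvs M N X L Y"
  shows "distr M (N \<Otimes>\<^sub>M L) (\<lambda>\<omega>. (X \<omega>, Y \<omega>)) = distr M N X \<Otimes>\<^sub>M distr M L Y"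
proof -
  have X [measurable]: "X \<in> M \<rightarrow>\<^sub>M N" and Y [measurable]: "Y \<in> M \<rightarrow>\<^sub>M L"
    and ind: "indep_set {X -` A \<inter> space M | A. A \<in> sets N} {Y -` B \<inter> space M | B. B \<in> sets L}"
    using assms by (auto simp: indep_rvs_def)
  interpret X: prob_space "distr M N X" by (rule prob_space_distr) simp
  interpret Y: prob_space "distr M L Y" by (rule prob_space_distr) simp
  show ?thesis
  proof (rule pair_measure_eqI[symmetric])
    show "sigma_finite_measure (distr M N X)" "sigma_finite_measure (distr M L Y)"
      by unfold_locales
    show "sets (distr M N X \<Otimes>\<^sub>M distr M L Y) = sets (distr M (N \<Otimes>\<^sub>M L) (\<lambda>\<omega>. (X \<omega>, Y \<omega>)))"
      by (simp cong: sets_pair_measure_cong)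
    fix A B assume "A \<in> sets (distr M N X)" "B \<in> sets (distr M L Y)"
    then have [measurable]: "A \<in> sets N" "B \<in> sets L" by auto
    have eq: "(\<lambda>\<omega>. (X \<omega>, Y \<omega>)) -` (A \<times> B) \<inter> space M = (X -` A \<inter> space M) \<inter> (Y -` B \<inter> space M)"
      by auto
    have "prob ((X -` A \<inter> space M) \<inter> (Y -` B \<inter> space M)) =
        prob (X -` A \<inter> space M) * prob (Y -` B \<inter> space M)"
      by (rule indep_setD[OF ind]) auto
    then show "emeasure (distr M N X) A * emeasure (distr M L Y) B =
        emeasure (distr M (N \<Otimes>\<^sub>M L) (\<lambda>\<omega>. (X \<omega>, Y \<omega>))) (A \<times> B)"
      by (simp add: emeasure_distr eq emeasure_eq_measure ennreal_mult)
  qed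
qed

lemma (in prob_space) exponential_1_prob_le_exp_uminus:
  assumes "distributed M lborel E (exponential_density 1)" and "0 \<le> a"
  shows "\<P>(\<omega> in M. a \<le> exp (- E \<omega>)) = 1 - min 1 a"
proof -
  have [measurable]: "E \<in> borel_measurable M"
    using distributed_measurable[OF assms(1)] by simp
  have le: "\<P>(\<omega> in M. E \<omega> \<le> x) = 1 - exp (- x)" if "0 \<le> x" for x
    using exponential_distributedD_le[OF assms(1) that] by simp
  \<comment> \<open>The inversion \<open>E \<omega> \<le> - ln a\<close> requires
    \<open>0 < a\<close>, and the exponential cdf formula applies at \<open>- ln a\<close> only when
    that point is nonnegative, that is, when \<open>a \<le> 1\<close>.\<close>
  consider "a = 0" | "0 < a" "a \<le> 1" | "1 < a" using assms(2) by linarith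
  then show ?thesis
  proof cases
    case 1
    then show ?thesis by (simp add: prob_space)
  next
    case 2
    then have "a \<le> exp (- E \<omega>) \<longleftrightarrow> E \<omega> \<le> - ln a" for \<omega>
      by (metis exp_le_cancel_iff exp_ln minus_le_iff le_minus_iff)
    then show ?thesis using 2 le[of "- ln a"] by simp
  next
    case 3
    \<comment> \<open>For \<open>a > 1\<close> the event forces \<open>E\<close> to be negative, so
      a null event contains it.\<close>
    have "\<P>(\<omega> in M. a \<le> exp (- E \<omega>)) \<le> \<P>(\<omega> in M. E \<omega> \<le> 0)"
    proof (rule finite_measure_mono)
      have "E \<omega> \<le> 0" if "a \<le> exp (- E \<omega>)" for \<omega>
      proof -
        have "1 \<le> exp (- E \<omega>)" using that 3 by linarith
        then show ?thesis by simp
      qed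
      then show "{\<omega> \<in> space M. a \<le> exp (- E \<omega>)} \<subseteq> {\<omega> \<in> space M. E \<omega> \<le> 0}" by auto
    qed measurable
    also have "\<dots> = 0" using le[of 0] by simp
    finally show ?thesis using 3 by (simp add: measure_le_0_iff)
  qed
qed

lemma (in prob_space) exponential_1_pos_AE:
  assumes "distributed M lborel E (exponential_density 1)"
  shows "AE \<omega> in M. 0 < E \<omega>"
proof -
  have [measurable]: "E \<in> borel_measurable M"
    using distributed_measurable[OF assms(1)] by simp
  have "\<P>(\<omega> in M. E \<omega> \<le> 0) = 0"
    using exponential_distributedD_le[OF assms(1), of 0] by simp
  then have "AE \<omega> in M. \<not> E \<omega> \<le> 0"
    by (subst (asm) prob_eq_0) auto
  then show ?thesis by (simp add: not_le)
qed

section \<open>Spectral random vectors\<close>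

text \<open>Since \<open>exp (- min z 0) = max 1 (exp (- z))\<close> and the weights are
  nonnegative, each product is a maximum of two terms. Exchanging the two maxima isolates
  \<open>MAX j. w j\<close>, which is normalised to 1.\<close>

lemma Max_mult_max_1:
  fixes w z :: "'d::finite \<Rightarrow> real"
  assumes "\<And>j. 0 \<le> w j" and "(MAX j. w j) = 1"
  shows "(MAX j. exp (- min (z j) 0) * w j) = max 1 (MAX j. exp (- z j) * w j)"
proof -
  have *: "exp (- min (z j) 0) * w j = max (w j) (exp (- z j) * w j)" for j
    using assms(1)[of j] mult_right_mono[of 1 "exp (- z j)" "w j"]
      mult_right_mono[of "exp (- z j)" 1 "w j"]
    by (auto simp: min_def max_def)
  have "(MAX j. max (w j) (exp (- z j) * w j)) = max (MAX j. w j) (MAX j. exp (- z j) * w j)"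
    (is "Max (range ?m) = _")
  proof (rule antisym)
    show "Max (range ?m) \<le> max (MAX j. w j) (MAX j. exp (- z j) * w j)"
      by (auto intro!: Max.boundedI max.mono simp del: max.bounded_iff)
    have "?m j \<le> Max (range ?m)" for j
      by (rule Max_ge) auto
    then show "max (MAX j. w j) (MAX j. exp (- z j) * w j) \<le> Max (range ?m)"
      by (auto simp del: Max_ge_iff)
  qed
  then show ?thesis by (simp add: * assms(2))
qed

locale spectral = prob_space M for M :: "'a measure" +
  fixes S :: "'a \<Rightarrow> 'd::finite \<Rightarrow> ereal"
  assumes spectral: "spectral_random_vector M S"
begin

lemma measurable_S [measurable]: "S \<in> M \<rightarrow>\<^sub>M ereal_vectors"
  using spectral by (simp add: spectral_random_vector_def)

lemma measurable_S_component [measurable]: "(\<lambda>\<omega>. S \<omega> j) \<in> borel_measurable M"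
  using measurable_compose[OF measurable_S measurable_component_singleton[of j]] by simp

lemma S_le_0: "\<omega> \<in> space M \<Longrightarrow> S \<omega> j \<le> 0"
  using spectral by (simp add: spectral_random_vector_def)

lemma S_not_PInf: "\<omega> \<in> space M \<Longrightarrow> S \<omega> j \<noteq> \<infinity>"
  using S_le_0[of \<omega> j] by auto

lemma Max_S_AE: "AE \<omega> in M. (MAX j. S \<omega> j) = 0"
proof -
  have "\<P>(\<omega> in M. (MAX j. S \<omega> j) = 0) = 1"
    using spectral by (simp add: spectral_random_vector_def)
  then show ?thesis by (subst (asm) prob_eq_1) auto
qed

text \<open>The normalisation of \<open>S\<close> carries over to the exponential scale, as
  \<open>exp_ereal\<close> commutes with the maximum and sends 0 to 1.\<close>

lemma Max_exp_S_AE: "AE \<omega> in M. (MAX j. exp_ereal (S \<omega> j)) = 1"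
  using Max_S_AE AE_space
proof eventually_elim
  case (elim \<omega>)
  then show ?case
    using exp_ereal_Max[of "S \<omega>"] by (simp add: S_not_PInf)
qed

text \<open>Links \<open>exp_ereal\<close> of the maximum of S - z to the weighted maximum used in
  the computations. As \<open>S \<le> 0\<close> on all of \<open>space M\<close>, no coordinate is
  \<infinity> and no null set has to be discarded.\<close>

lemma exp_ereal_Max_minus:
  "\<omega> \<in> space M \<Longrightarrow>
    exp_ereal (MAX j. S \<omega> j - ereal (z j)) = (MAX j. exp (- z j) * exp_ereal (S \<omega> j))"
  by (subst exp_ereal_Max) (simp_all add: S_not_PInf exp_ereal_minus ereal_minus_eq_PInfty_iff)

lemma integrable_exp_S [simp, intro]: "integrable M (\<lambda>\<omega>. exp_ereal (S \<omega> j))"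
  by (rule integrable_const_bound[where B = 1]) (auto simp: S_le_0 exp_ereal_le_1)

text \<open>Every \<open>exp_ereal (S \<omega> j)\<close> lies in [0,1], so the maximum is bounded
  by the largest coefficient.\<close>

lemma integrable_Max_exp_S:
  fixes c :: "'d \<Rightarrow> real"
  assumes "\<And>j. 0 \<le> c j"
  shows "integrable M (\<lambda>\<omega>. MAX j. c j * exp_ereal (S \<omega> j))"
proof (rule integrable_const_bound[where B = "MAX j. c j"])
  show "AE \<omega> in M. norm (MAX j. c j * exp_ereal (S \<omega> j)) \<le> (MAX j. c j)"
  proof (rule AE_I2)
    fix \<omega> assume \<omega>: "\<omega> \<in> space M"
    have "0 \<le> c j * exp_ereal (S \<omega> j)" for j
      using assms by simp
    then have "0 \<le> (MAX j. c j * exp_ereal (S \<omega> j))"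
      by (auto simp: Max_ge_iff)
    moreover have "c j * exp_ereal (S \<omega> j) \<le> (MAX j. c j)" for j
      using mult_left_mono[OF exp_ereal_le_1[OF S_le_0[OF \<omega>]] assms, of j j]
      by (simp add: order_trans[OF _ Max_ge[OF _ rangeI]])
    ultimately show "norm (MAX j. c j * exp_ereal (S \<omega> j)) \<le> (MAX j. c j)"
      by auto
  qed
qed measurable

lemma expectation_exp_S_le_1: "expectation (\<lambda>\<omega>. exp_ereal (S \<omega> j)) \<le> 1"
  using integral_mono[OF integrable_exp_S[of j] integrable_const[of 1]]
  by (simp add: S_le_0 exp_ereal_le_1 prob_space)

text \<open>A zero mean would make the nonnegative variable vanish almost surely, so that
  \<open>S \<omega> j = -\<infinity>\<close> almost surely, which a spectral vector excludes. This
  justifies dividing by the mean.\<close>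

lemma expectation_exp_S_pos: "0 < expectation (\<lambda>\<omega>. exp_ereal (S \<omega> j))"
proof -
  have "{\<omega> \<in> space M. exp_ereal (S \<omega> j) \<noteq> 0} = {\<omega> \<in> space M. S \<omega> j > -\<infinity>}"
    using exp_ereal_pos_iff[OF S_not_PInf] by (auto simp: less_le)
  then have "prob {\<omega> \<in> space M. exp_ereal (S \<omega> j) \<noteq> 0} \<noteq> 0"
    using spectral by (auto simp: spectral_random_vector_def less_le)
  then have "\<not> (AE \<omega> in M. exp_ereal (S \<omega> j) = 0)"
    by (subst (asm) prob_eq_0) auto
  then show ?thesis
    using integral_nonneg_eq_0_iff_AE[OF integrable_exp_S[of j]]
    by (simp add: less_le integral_nonneg_AE)
qed

text \<open>The generating vector is \<open>W\<close>, whose components have mean 1 by the choice of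
  \<open>p\<close>. Since \<open>is_stdf\<close> asks for a probability space on
  \<open>'d \<Rightarrow> real\<close>, the law of \<open>W\<close> serves as that space.\<close>

lemma is_stdf_spectral:
  assumes p: "\<And>j. p j = expectation (\<lambda>\<omega>. exp_ereal (S \<omega> j))"
    and l: "\<And>y. \<forall>j. 0 \<le> y j \<Longrightarrow> l y = expectation (\<lambda>\<omega>. MAX j. y j * exp_ereal (S \<omega> j) / p j)"
  shows "is_stdf l"
proof -
  have p_pos: "0 < p j" for j
    using expectation_exp_S_pos by (simp add: p)
  define W where "W = (\<lambda>\<omega> j. exp_ereal (S \<omega> j) / p j)"
  have W [measurable]: "W \<in> M \<rightarrow>\<^sub>M real_vectors"
    unfolding W_def by (rule measurable_PiM_single') auto
  \<comment> \<open>The positive part makes \<open>V\<close> nonnegative on the whole space and agrees with the identity on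
    the range of \<open>W\<close>.\<close>
  define V :: "('d \<Rightarrow> real) \<Rightarrow> 'd \<Rightarrow> real" where "V = (\<lambda>x j. max 0 (x j))"
  have V [measurable]: "V \<in> real_vectors \<rightarrow>\<^sub>M real_vectors"
    unfolding V_def by (rule measurable_PiM_single') auto
  have VW: "V (W \<omega>) j = exp_ereal (S \<omega> j) / p j" for \<omega> j
    using p_pos[of j] by (simp add: V_def W_def)
  have comp [measurable]: "(\<lambda>x. V x j) \<in> borel_measurable real_vectors" for j
    using measurable_compose[OF V measurable_component_singleton[of j]] by simp
  show ?thesis
    unfolding is_stdf_def
  proof (intro exI conjI allI impI ballI)
    show "prob_space (distr M real_vectors W)"
      by (rule prob_space_distr) simp
    show "V \<in> distr M real_vectors W \<rightarrow>\<^sub>M real_vectors" by simp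
    show "0 \<le> V x j" for x j by (simp add: V_def)
    have "has_bochner_integral M (\<lambda>\<omega>. exp_ereal (S \<omega> j) / p j) (p j / p j)" for j
      unfolding p
      by (intro has_bochner_integral_divide_zero has_bochner_integral_integrable) auto
    then have "has_bochner_integral M (\<lambda>\<omega>. V (W \<omega>) j) 1" for j
      using p_pos by (simp add: VW less_imp_neq[symmetric])
    then show "has_bochner_integral (distr M real_vectors W) (\<lambda>x. V x j) 1" for j
      by (simp add: has_bochner_integral_iff integrable_distr_eq integral_distr)
    show "l y = (\<integral>x. (MAX j. y j * V x j) \<partial>distr M real_vectors W)" if "\<forall>j. 0 \<le> y j" for y
      by (subst integral_distr) (auto simp: VW l[OF that])
  qed
qed

end

section \<open>The sum of a spectral vector and an independent unit exponential\<close>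

locale spectral_exponential = spectral M S for M :: "'a measure" and S :: "'a \<Rightarrow> 'd::finite \<Rightarrow> ereal" +
  fixes E :: "'a \<Rightarrow> real"
  assumes E: "distributed M lborel E (exponential_density 1)"
    and indep: "indep_rvs M ereal_vectors S borel E"
begin

lemma measurable_E [measurable]: "E \<in> borel_measurable M"
  using distributed_measurable[OF E] by simp

lemma measurable_S_plus_E [measurable]: "(\<lambda>\<omega> j. S \<omega> j + ereal (E \<omega>)) \<in> M \<rightarrow>\<^sub>M ereal_vectors"
  by (rule measurable_PiM_single') auto

text \<open>Fubini for the joint law: fix the value \<open>s\<close> of the spectral vector, find
  the probability of the section in the exponential variable, then average over
  \<open>s\<close>.\<close>

lemma vec_cdf_S_plus_E:
  "vec_cdf (distr M ereal_vectors (\<lambda>\<omega> j. S \<omega> j + ereal (E \<omega>))) z =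
    1 - expectation (\<lambda>\<omega>. min 1 (MAX j. exp (- z j) * exp_ereal (S \<omega> j)))"
proof -
  define a where "a = (\<lambda>s::'d \<Rightarrow> ereal. MAX j. exp (- z j) * exp_ereal (s j))"
  have comp [measurable]: "(\<lambda>s. s j) \<in> borel_measurable (ereal_vectors :: ('d \<Rightarrow> ereal) measure)" for j
    using measurable_component_singleton[of j UNIV] by simp
  have a [measurable]: "a \<in> borel_measurable ereal_vectors"
    unfolding a_def by measurable
  have a_nonneg: "0 \<le> a s" for s
    by (auto simp: a_def Max_ge_iff)
  interpret DE: prob_space "distr M borel E" by (rule prob_space_distr) simp
  \<comment> \<open>The cdf event is described in the space of values, so that its probability
    depends only on the joint law of \<open>S\<close> and \<open>E\<close>.\<close>
  define T where "T = {x :: ('d \<Rightarrow> ereal) \<times> real. a (fst x) \<le> exp (- snd x)}"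
  have T [measurable]: "T \<in> sets (ereal_vectors \<Otimes>\<^sub>M borel)"
  proof -
    have "{x \<in> space ((ereal_vectors :: ('d \<Rightarrow> ereal) measure) \<Otimes>\<^sub>M borel). a (fst x) \<le> exp (- snd x)}
        \<in> sets (ereal_vectors \<Otimes>\<^sub>M borel)"
      by measurable
    then show ?thesis by (simp add: T_def space_pair_measure space_PiM)
  qed
  have event: "(\<forall>j. S \<omega> j + ereal (E \<omega>) \<le> ereal (z j)) \<longleftrightarrow> (S \<omega>, E \<omega>) \<in> T"
    if "\<omega> \<in> space M" for \<omega>
    using that by (auto simp: T_def a_def add_ereal_le_iff_exp_ereal S_not_PInf)
  have section_T: "emeasure (distr M borel E) (Pair s -` T) = ennreal (1 - min 1 (a s))" for s
  proof -
    have [measurable]: "Pair s -` T \<in> sets borel"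
      using sets_Pair1[OF T] .
    have "E -` Pair s -` T \<inter> space M = {\<omega> \<in> space M. a s \<le> exp (- E \<omega>)}"
      by (auto simp: T_def)
    then show ?thesis
      using exponential_1_prob_le_exp_uminus[OF E a_nonneg[of s]]
      by (simp add: emeasure_distr emeasure_eq_measure)
  qed
  have int: "integrable M (\<lambda>\<omega>. min 1 (a (S \<omega>)))"
    using a_nonneg by (intro integrable_const_bound[where B = 1]) auto
  have "vec_cdf (distr M ereal_vectors (\<lambda>\<omega> j. S \<omega> j + ereal (E \<omega>))) z =
      \<P>(\<omega> in M. \<forall>j. S \<omega> j + ereal (E \<omega>) \<le> ereal (z j))"
  proof -
    have "{x \<in> space (ereal_vectors :: ('d \<Rightarrow> ereal) measure). \<forall>j. x j \<le> ereal (z j)} \<in> sets ereal_vectors"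
      by measurable
    then show ?thesis
      unfolding vec_cdf_def
      by (simp add: measure_distr space_PiM vimage_def Int_def conj_commute)
  qed
  also have "\<dots> = prob ((\<lambda>\<omega>. (S \<omega>, E \<omega>)) -` T \<inter> space M)"
    using event by (intro arg_cong[where f = prob]) auto
  finally have "ennreal (vec_cdf (distr M ereal_vectors (\<lambda>\<omega> j. S \<omega> j + ereal (E \<omega>))) z) =
      emeasure (distr M (ereal_vectors \<Otimes>\<^sub>M borel) (\<lambda>\<omega>. (S \<omega>, E \<omega>))) T"
    by (simp add: emeasure_distr emeasure_eq_measure)
  \<comment> \<open>Independence enters here, factoring the joint law.\<close>
  also have "\<dots> = emeasure (distr M ereal_vectors S \<Otimes>\<^sub>M distr M borel E) T"
    by (simp add: indep_rvs_distr_pair[OF indep])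
  also have "\<dots> = (\<integral>\<^sup>+ s. ennreal (1 - min 1 (a s)) \<partial>distr M ereal_vectors S)"
    by (subst DE.emeasure_pair_measure_alt) (auto simp: section_T cong: sets_pair_measure_cong)
  also have "\<dots> = (\<integral>\<^sup>+ \<omega>. ennreal (1 - min 1 (a (S \<omega>))) \<partial>M)"
    by (subst nn_integral_distr) auto
  also have "\<dots> = ennreal (expectation (\<lambda>\<omega>. 1 - min 1 (a (S \<omega>))))"
    using int by (intro nn_integral_eq_integral) auto
  also have "expectation (\<lambda>\<omega>. 1 - min 1 (a (S \<omega>))) = 1 - expectation (\<lambda>\<omega>. min 1 (a (S \<omega>)))"
    using int by (simp add: prob_space)
  finally have *: "ennreal (vec_cdf (distr M ereal_vectors (\<lambda>\<omega> j. S \<omega> j + ereal (E \<omega>))) z) =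
      ennreal (1 - expectation (\<lambda>\<omega>. min 1 (a (S \<omega>))))" .
  \<comment> \<open>\<open>ennreal\<close> sends all negative reals to 0, so the equality
    \<open>*\<close> yields one of reals only after both sides are known to be nonnegative.\<close>
  have "expectation (\<lambda>\<omega>. min 1 (a (S \<omega>))) \<le> expectation (\<lambda>\<omega>. 1)"
    using int by (intro integral_mono) auto
  then have "0 \<le> 1 - expectation (\<lambda>\<omega>. min 1 (a (S \<omega>)))"
    by (simp add: prob_space)
  with * show ?thesis
    by (simp add: vec_cdf_def a_def)
qed

text \<open>Almost surely some coordinate of \<open>S\<close> attains the maximum 0; there the sum
  equals \<open>E\<close>, which is positive. Finiteness from above holds because
  \<open>S \<le> 0\<close> and \<open>E\<close> is real.\<close>

lemma S_plus_E_support_AE: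
  "AE x in distr M ereal_vectors (\<lambda>\<omega> j. S \<omega> j + ereal (E \<omega>)).
    (\<forall>j. x j < \<infinity>) \<and> \<not> (\<forall>j. x j \<le> 0)"
proof -
  have comp [measurable]: "(\<lambda>s. s j) \<in> borel_measurable (ereal_vectors :: ('d \<Rightarrow> ereal) measure)" for j
    using measurable_component_singleton[of j UNIV] by simp
  have "AE \<omega> in M. (\<forall>j. S \<omega> j + ereal (E \<omega>) < \<infinity>) \<and> \<not> (\<forall>j. S \<omega> j + ereal (E \<omega>) \<le> 0)"
    using Max_S_AE exponential_1_pos_AE[OF E] AE_space
  proof eventually_elim
    case (elim \<omega>)
    have "(MAX j. S \<omega> j) \<in> range (S \<omega>)"
      by (rule Max_in) auto
    then obtain j where "S \<omega> j = 0"
      using elim(1) by auto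
    then have "\<not> S \<omega> j + ereal (E \<omega>) \<le> 0"
      using elim(2) by simp
    then show ?case
      using S_not_PInf[OF elim(3)] by auto
  qed
  then show ?thesis
    by (subst AE_distr_iff) auto
qed

end

section \<open>Identification of the law of the sum as generalized Pareto\<close>

theorem theorem4p3:
  fixes M :: "'a measure"
    and S :: "'a \<Rightarrow> 'd::finite \<Rightarrow> ereal"
    and E :: "'a \<Rightarrow> real"
    and p :: "'d \<Rightarrow> real"
    and l :: "('d \<Rightarrow> real) \<Rightarrow> real"
  assumes "prob_space M"
    and "spectral_random_vector M S"
    and "distributed M lborel E (exponential_density 1)"
    and "indep_rvs M ereal_vectors S borel E"
    and "\<And>j. p j = (\<integral>\<omega>. exp_ereal (S \<omega> j) \<partial>M)"
    and "\<And>y. \<forall>j. 0 \<le> y j \<Longrightarrow> l y = (\<integral>\<omega>. (MAX j. y j * exp_ereal (S \<omega> j) / p j) \<partial>M)"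
  shows "is_GP_std (distr M ereal_vectors (\<lambda>\<omega> j. S \<omega> j + ereal (E \<omega>))) p l \<and>
    (\<forall>z. vec_cdf (distr M ereal_vectors (\<lambda>\<omega> j. S \<omega> j + ereal (E \<omega>))) z =
       1 - (\<integral>\<omega>. min 1 (exp_ereal (MAX j. S \<omega> j - ereal (z j))) \<partial>M))"
proof -
  interpret spectral_exponential M S E
    using assms by (simp add: spectral_exponential_def spectral_exponential_axioms_def
      spectral_def spectral_axioms_def)
  let ?\<mu> = "distr M ereal_vectors (\<lambda>\<omega> j. S \<omega> j + ereal (E \<omega>))"
  have p: "0 < p j" "p j \<le> 1" for j
    using expectation_exp_S_pos expectation_exp_S_le_1 by (simp_all add: assms(5))
  have p_nz: "p j \<noteq> 0" for j
    using p(1)[of j] by simp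
  \<comment> \<open>The factor \<open>p j\<close> cancels the division in \<open>l\<close>. The
    choices 1, \<open>exp (- min (z j) 0)\<close> and \<open>exp (- z j)\<close> for
    \<open>c j\<close> give \<open>l p\<close> and both terms of the cdf.\<close>
  have l_scaled: "l (\<lambda>j. p j * c j) = expectation (\<lambda>\<omega>. MAX j. c j * exp_ereal (S \<omega> j))"
    if "\<And>j. 0 \<le> c j" for c
    using that p(1) by (subst assms(6)) (simp_all add: p_nz less_imp_le)
  have "l p = expectation (\<lambda>\<omega>. MAX j. exp_ereal (S \<omega> j))"
    using l_scaled[of "\<lambda>_. 1"] by simp
  also have "\<dots> = expectation (\<lambda>\<omega>. 1)"
    using Max_exp_S_AE by (intro integral_cong_AE) auto
  finally have l_p: "l p = 1"
    by (simp add: prob_space)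
  have cdf: "vec_cdf ?\<mu> z =
      l (\<lambda>j. p j * exp (- min (z j) 0)) - l (\<lambda>j. p j * exp (- z j))" for z
  proof -
    let ?a = "\<lambda>\<omega>. MAX j. exp (- z j) * exp_ereal (S \<omega> j)"
    have int: "integrable M ?a"
      by (rule integrable_Max_exp_S) simp
    have "l (\<lambda>j. p j * exp (- min (z j) 0)) = expectation (\<lambda>\<omega>. max 1 (?a \<omega>))"
      unfolding l_scaled[of "\<lambda>j. exp (- min (z j) 0)", OF exp_ge_zero]
    proof (rule integral_cong_AE)
      show "AE \<omega> in M. (MAX j. exp (- min (z j) 0) * exp_ereal (S \<omega> j)) = max 1 (?a \<omega>)"
        using Max_exp_S_AE by eventually_elim (rule Max_mult_max_1, auto)
    qed measurable
    moreover have "l (\<lambda>j. p j * exp (- z j)) = expectation ?a"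
      by (rule l_scaled) simp
    \<comment> \<open>Maximum plus minimum of two numbers is their sum; taking expectations turns
      the difference of the two values of \<open>l\<close> into
      \<open>1 - expectation (\<lambda>\<omega>. min 1 (?a \<omega>))\<close>.\<close>
    moreover have "expectation (\<lambda>\<omega>. max 1 (?a \<omega>)) + expectation (\<lambda>\<omega>. min 1 (?a \<omega>)) =
        expectation (\<lambda>\<omega>. 1 + ?a \<omega>)"
    proof -
      have "max 1 (?a \<omega>) + min 1 (?a \<omega>) = 1 + ?a \<omega>" for \<omega>
        by (simp add: max_def min_def)
      moreover have "integrable M (\<lambda>\<omega>. max 1 (?a \<omega>))" "integrable M (\<lambda>\<omega>. min 1 (?a \<omega>))"
        using int by (auto intro: integrable_max integrable_min)
      ultimately show ?thesis
        by (simp flip: Bochner_Integration.integral_add)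
    qed
    moreover have "expectation (\<lambda>\<omega>. 1 + ?a \<omega>) = 1 + expectation ?a"
      using int by (simp add: prob_space)
    ultimately show ?thesis
      by (simp add: vec_cdf_S_plus_E)
  qed
  have "is_GP_std ?\<mu> p l"
    unfolding is_GP_std_def
    using p l_p cdf S_plus_E_support_AE is_stdf_spectral[of p l] assms(5,6)
    by (simp add: prob_space_distr)
  \<comment> \<open>The two forms of the integrand are identified only on \<open>space M\<close>, so
    the rewriting goes through integral congruence.\<close>
  moreover have "vec_cdf ?\<mu> z =
      1 - expectation (\<lambda>\<omega>. min 1 (exp_ereal (MAX j. S \<omega> j - ereal (z j))))" for z
    unfolding vec_cdf_S_plus_E
    by (simp add: exp_ereal_Max_minus cong: Bochner_Integration.integral_cong)
  ultimately show ?thesis by blast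
qed

end
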